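(* For every nondegenerate Euclidean triangle $T$ there is a convex polyhedron in $\mathbb{R}^3$ with exactly eight faces, each of them congruent to $T$.
   Context: A convex polyhedron is a three-dimensional convex polytope in $\mathbb{R}^3$ (the convex hull of finitely many points, with nonempty interior); its faces are its two-dimensional faces (facets), so distinct faces lie in distinct planes. Congruence means ordinary Euclidean congruence, including orientation-reversing isometries (reflected copies are allowed); thus a triangular face is congruent to $T$ if and only if it has the same three side lengths, with multiplicity, as $T$. *)

theory Defs
  imports "HOL-Analysis.Analysis"
begin

(* The isometry f acts on the whole space and may reverse orientation; a distance-preserving
   self-map of a Euclidean space is automatically bijective. *)
definition euclidean_congruent :: "'a::euclidean_space set \<Rightarrow> 'a set \<Rightarrow> bool" where
  "euclidean_congruent S T \<longleftrightarrow> (\<exists>f. (\<forall>x y. dist (f x) (f y) = dist x y) \<and> f ` S = T)"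

definition nondegenerate_triangle :: "'a::euclidean_space set \<Rightarrow> bool" where
  "nondegenerate_triangle T \<longleftrightarrow> (\<exists>a b c. \<not> collinear {a, b, c} \<and> T = convex hull {a, b, c})"

definition convex_polyhedron :: "(real ^ 3) set \<Rightarrow> bool" where
  "convex_polyhedron P \<longleftrightarrow> polytope P \<and> interior P \<noteq> {}"

end

theory Submission
  imports Defs
begin

text \<open>
The polyhedron is an octahedron whose equator is a skew quadrilateral. Take two poles
\<open>(0, 0, \<plusminus>t)\<close>, two vertices \<open>(\<plusminus>p, 0, h)\<close> raised to height \<open>h\<close> and two vertices
\<open>(0, \<plusminus>p, -h)\<close> lowered by the same amount. Each of the eight faces spans one vertex of each kind. The
equatorial edges all have squared length \<open>2 p^2 + 4 h^2\<close>; a pole is joined to the equator by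
edges of squared lengths \<open>p^2 + (t - h)^2\<close> and \<open>p^2 + (t + h)^2\<close>, and passing to the other pole only
interchanges the two. Hence all faces have the same three side lengths.

For \<open>h = 0\<close> only isosceles faces occur; the skewness \<open>h\<close> gives the third degree of freedom
needed to realise every triangle. Let two sides, as vectors \<open>u\<close> and \<open>v\<close> from a common vertex,
be the polar edges and let \<open>u - v\<close> be the equatorial one. The length conditions become
\<open>t^2 - h^2 = u \<bullet> v\<close>, \<open>2 t h = (v \<bullet> v - u \<bullet> u) / 2\<close> and
\<open>2 p^2 = (u - v) \<bullet> (u - v) - 4 h^2\<close>. The first two say that \<open>t + i h\<close> is a complex square root
of a given number, so they are solvable; positivity of the resulting \<open>p^2\<close> turns out to be the
strict Cauchy-Schwarz inequality for \<open>u\<close> and \<open>v\<close>, that is, nondegeneracy of the triangle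
(lemma \<open>octahedron_parameters\<close>).

The octahedron is strictly convex with these eight faces when \<open>\<bar>h\<bar> < t\<close>, which amounts to
\<open>u \<bullet> v > 0\<close>. So the angle between the polar edges has to be acute, and every
triangle has an acute angle (\<open>acute_angle_exists\<close>). That there are no further facets follows from
the description of the octahedron by eight half-spaces (\<open>body_halfspaces\<close>), and equality of side
lengths is turned into a congruence of the whole space by composing reflections
(\<open>isometry_extension\<close>).
\<close>

section \<open>Isometries matching congruent point configurations\<close>

text \<open>
For \<open>a \<noteq> b\<close> this is the reflection in the perpendicular bisector of \<open>a\<close> and \<open>b\<close>. For
\<open>a = b\<close> it is the identity, which spares a case distinction in the induction below.
\<close>
definition bisector_reflection :: "'a::euclidean_space \<Rightarrow> 'a \<Rightarrow> 'a \<Rightarrow> 'a" where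
  "bisector_reflection a b x =
     x - (2 * ((x - midpoint a b) \<bullet> (a - b)) / ((a - b) \<bullet> (a - b))) *\<^sub>R (a - b)"

lemma dist_bisector_reflection:
  "dist (bisector_reflection a b x) (bisector_reflection a b y) = dist x y"
proof (cases "a = b")
  case False
  define w where "w = a - b"
  define z where "z = x - y"
  have w: "w \<bullet> w \<noteq> 0"
    using False by (simp add: w_def)
  have diff: "bisector_reflection a b x - bisector_reflection a b y
        = z - (2 * (z \<bullet> w) / (w \<bullet> w)) *\<^sub>R w"
    unfolding bisector_reflection_def w_def [symmetric] z_def
    by (simp add: algebra_simps inner_diff_left diff_divide_distrib)
  have "(z - (2 * (z \<bullet> w) / (w \<bullet> w)) *\<^sub>R w) \<bullet> (z - (2 * (z \<bullet> w) / (w \<bullet> w)) *\<^sub>R w) = z \<bullet> z"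
    using w by (simp add: inner_diff_left inner_diff_right inner_commute field_simps)
  then show ?thesis
    by (simp add: dist_norm norm_eq_sqrt_inner diff z_def)
qed (simp add: bisector_reflection_def)

lemma bisector_reflection_swap: "bisector_reflection a b a = b"
proof (cases "a = b")
  case False
  have "a - midpoint a b = (1/2) *\<^sub>R (a - b)"
    by (simp add: midpoint_def algebra_simps flip: scaleR_add_left)
  then show ?thesis
    using False by (simp add: bisector_reflection_def)
qed (simp add: bisector_reflection_def)

lemma bisector_reflection_fix:
  assumes "dist x a = dist x b"
  shows "bisector_reflection a b x = x"
proof -
  have "(x - a) \<bullet> (x - a) = (x - b) \<bullet> (x - b)"
    using assms by (simp add: dist_norm norm_eq_sqrt_inner)
  then have "(x - midpoint a b) \<bullet> (a - b) = 0"
    by (simp add: midpoint_def algebra_simps inner_diff_left inner_diff_right inner_add_left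
        inner_add_right inner_commute)
  then show ?thesis
    by (simp add: bisector_reflection_def)
qed

text \<open>
Two configurations with equal mutual distances are matched point by point: once the points in
\<open>I\<close> are in place, the bisector reflection that moves the next point to its target leaves all of
them alone, since each is as far from the current position as from the target.
\<close>
lemma isometry_extension:
  fixes p q :: "'i \<Rightarrow> 'a::euclidean_space"
  assumes "finite I"
    and "\<And>i j. i \<in> I \<Longrightarrow> j \<in> I \<Longrightarrow> dist (p i) (p j) = dist (q i) (q j)"
  shows "\<exists>f. (\<forall>x y. dist (f x) (f y) = dist x y) \<and> (\<forall>i\<in>I. f (p i) = q i)"
  using assms
proof (induction I)
  case empty
  show ?case
    by (rule exI [of _ "\<lambda>x. x"]) simp
next
  case (insert k I)
  then have "\<exists>f. (\<forall>x y. dist (f x) (f y) = dist x y) \<and> (\<forall>i\<in>I. f (p i) = q i)"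
    by blast
  then obtain f where f: "\<And>x y. dist (f x) (f y) = dist x y" "\<And>i. i \<in> I \<Longrightarrow> f (p i) = q i"
    by blast
  let ?r = "bisector_reflection (f (p k)) (q k)"
  have "?r (f (p i)) = q i" if "i \<in> I" for i
  proof -
    have "dist (q i) (f (p k)) = dist (q i) (q k)"
      using f that insert.prems by (metis insertCI)
    then show ?thesis
      using f(2) that by (simp add: bisector_reflection_fix)
  qed
  then show ?case
    by (intro exI [of _ "?r \<circ> f"]) (simp add: f dist_bisector_reflection bisector_reflection_swap)
qed

text \<open>
An affine form of isometries, needed because convex hulls and dimensions are known to be
preserved by translations and linear maps.
\<close>
lemma isometry_translation_linear:
  fixes f :: "'a::euclidean_space \<Rightarrow> 'a"
  assumes "\<And>x y. dist (f x) (f y) = dist x y"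
  obtains c g where "linear g" "inj g" "f = (+) c \<circ> g"
proof
  let ?g = "\<lambda>x. f x - f 0"
  have g: "orthogonal_transformation ?g"
    using assms by (simp add: orthogonal_transformation_isometry dist_norm)
  then show "linear ?g" "inj ?g"
    by (rule orthogonal_transformation_linear, rule orthogonal_transformation_inj)
  show "f = (+) (f 0) \<circ> ?g"
    by (simp add: fun_eq_iff)
qed

lemma euclidean_congruent_triangles:
  fixes a b c :: "'a::euclidean_space"
  assumes "dist a b = dist a' b'" "dist a c = dist a' c'" "dist b c = dist b' c'"
  shows "euclidean_congruent (convex hull {a, b, c}) (convex hull {a', b', c'})"
proof -
  define p q where "p = (\<lambda>i::nat. [a, b, c] ! i)" and "q = (\<lambda>i::nat. [a', b', c'] ! i)"
  have "dist (p i) (p j) = dist (q i) (q j)" if "i \<in> {0,1,2}" "j \<in> {0,1,2}" for i j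
    using that assms by (auto simp: p_def q_def dist_commute)
  then obtain f where f: "\<And>x y. dist (f x) (f y) = dist x y" "\<And>i. i \<in> {0,1,2} \<Longrightarrow> f (p i) = q i"
    using isometry_extension [of "{0,1,2}" p q] by auto
  obtain k g where g: "linear g" "inj g" and fg: "f = (+) k \<circ> g"
    by (rule isometry_translation_linear [OF f(1)])
  have "f ` {a, b, c} = {a', b', c'}"
    using f(2)[of 0] f(2)[of 1] f(2)[of 2] by (simp add: p_def q_def)
  then have "f ` (convex hull {a, b, c}) = convex hull {a', b', c'}"
    unfolding fg image_comp [symmetric]
    by (simp only: convex_hull_translation [symmetric] convex_hull_linear_image [OF g(1)])
  then show ?thesis
    using f(1) by (auto simp: euclidean_congruent_def)
qed

lemma aff_dim_euclidean_congruent: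
  assumes "euclidean_congruent S T"
  shows "aff_dim S = aff_dim T"
proof -
  obtain f where f: "\<And>x y. dist (f x) (f y) = dist x y" "f ` S = T"
    using assms by (auto simp: euclidean_congruent_def)
  obtain k g where g: "linear g" "inj g" and fg: "f = (+) k \<circ> g"
    by (rule isometry_translation_linear [OF f(1)])
  have "aff_dim (f ` S) = aff_dim (g ` S)"
    unfolding fg image_comp [symmetric] by (rule aff_dim_translation_eq)
  then show ?thesis
    using f(2) g by simp
qed

lemma aff_dim_triangle:
  assumes "\<not> collinear {a, b, c}"
  shows "aff_dim (convex hull {a, b, c :: 'a::euclidean_space}) = 2"
proof -
  have "aff_dim {a, b, c} \<le> int (card {a, b, c}) - 1"
    by (rule aff_dim_le_card) simp
  moreover have "card {a, b, c} \<le> 3"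
    by (simp add: card_insert_if)
  ultimately show ?thesis
    using assms by (simp add: collinear_aff_dim aff_dim_convex_hull)
qed

section \<open>Faces of the hull of a finite set\<close>

text \<open>
The part of a polytope in a supporting hyperplane is a face, and every face of a hull is spanned by
those generators that it contains.
\<close>
lemma convex_hull_Int_supporting_hyperplane:
  fixes S :: "'a::euclidean_space set"
  assumes "finite S" "T \<subseteq> S"
    and on: "\<And>x. x \<in> T \<Longrightarrow> n \<bullet> x = d"
    and below: "\<And>x. x \<in> S - T \<Longrightarrow> n \<bullet> x < d"
  shows "convex hull S \<inter> {x. n \<bullet> x = d} = convex hull T"
    and "convex hull T face_of convex hull S"
proof -
  let ?F = "convex hull S \<inter> {x. n \<bullet> x = d}"
  have "n \<bullet> x \<le> d" if "x \<in> S" for x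
    using on [of x] below [of x] that by (cases "x \<in> T") auto
  then have "S \<subseteq> {x. n \<bullet> x \<le> d}"
    by blast
  then have "convex hull S \<subseteq> {x. n \<bullet> x \<le> d}"
    by (intro hull_minimal convex_halfspace_le)
  then have face: "?F face_of convex hull S"
    by (intro face_of_Int_supporting_hyperplane_le) auto
  then obtain S' where S': "S' \<subseteq> S" "?F = convex hull S'"
    by (rule face_of_convex_hull_subset [OF finite_imp_compact [OF assms(1)]])
  have "S' \<subseteq> {x. n \<bullet> x = d}"
    using S'(2) hull_subset [of S' convex] by blast
  then have "S' \<subseteq> T"
    using S'(1) below by fastforce
  moreover have "convex hull T \<subseteq> ?F"
    by (rule hull_minimal) (use on assms(2) in \<open>auto simp: hull_inc convex_Int convex_hyperplane\<close>)
  ultimately show "?F = convex hull T"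
    using S'(2) hull_mono by blast
  then show "convex hull T face_of convex hull S"
    using face by simp
qed

text \<open>
A list of facets is complete as soon as it covers the boundary: a relative interior point of a
further facet \<open>G\<close> lies in some listed facet, which then contains all of \<open>G\<close> and has the
same dimension.
\<close>
lemma facets_eqI:
  fixes P :: "'a::euclidean_space set"
  assumes facets: "\<And>i. i \<in> I \<Longrightarrow> F i facet_of P"
    and cover: "P - interior P \<subseteq> (\<Union>i\<in>I. F i)"
  shows "{G. G facet_of P} = F ` I"
proof
  show "{G. G facet_of P} \<subseteq> F ` I"
  proof safe
    fix G assume G: "G facet_of P"
    then have face: "G face_of P" and sub: "G \<subseteq> P" and "G \<noteq> {}" "G \<noteq> P"
      by (auto simp: facet_of_def face_of_imp_subset)
    then obtain x where x: "x \<in> rel_interior G"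
      by (metis face_of_imp_convex rel_interior_eq_empty ex_in_conv)
    have "G \<inter> rel_interior P = {}"
      using face \<open>G \<noteq> P\<close> by (rule face_of_disjoint_rel_interior)
    then have "x \<notin> interior P"
      using x interior_subset_rel_interior rel_interior_subset by blast
    then obtain i where i: "i \<in> I" "x \<in> F i"
      using x sub cover rel_interior_subset by blast
    have Fi: "F i face_of P"
      using facets i(1) by (simp add: facet_of_def)
    then have "G \<subseteq> F i"
      using subset_of_face_of [OF _ sub] i x by blast
    then have "G face_of F i"
      using Fi face by (simp add: face_of_face)
    moreover have "aff_dim G = aff_dim (F i)"
      using G facets [OF i(1)] by (simp add: facet_of_def)
    ultimately have "G = F i"
      using face_of_aff_dim_lt [of "F i" G] Fi face_of_imp_convex by fastforce
    then show "G \<in> F ` I"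
      using i by blast
  qed
qed (use facets in auto)

lemma convex_combination_4:
  assumes "convex C" "a \<in> C" "b \<in> C" "c \<in> C" "d \<in> C"
    and "0 \<le> i" "0 \<le> j" "0 \<le> k" "0 \<le> l" "i + j + k + l = 1"
  shows "i *\<^sub>R a + j *\<^sub>R b + k *\<^sub>R c + l *\<^sub>R d \<in> C"
proof -
  have "(\<Sum>m\<in>{0,1,2,3::nat}. ([i, j, k, l] ! m) *\<^sub>R ([a, b, c, d] ! m)) \<in> C"
    by (rule convex_sum) (use assms in auto)
  then show ?thesis
    by (simp add: add.assoc)
qed

section \<open>The skew octahedron\<close>

abbreviation signs :: "real set" where
  "signs \<equiv> {-1, 1}"

locale skew_octahedron =
  fixes p h t :: real
  assumes p_pos: "0 < p" and height: "\<bar>h\<bar> < t"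
begin

definition pole :: "real \<Rightarrow> real ^ 3" where
  "pole \<sigma> = vector [0, 0, \<sigma> * t]"

definition upper :: "real \<Rightarrow> real ^ 3" where
  "upper r = vector [r * p, 0, h]"

definition lower :: "real \<Rightarrow> real ^ 3" where
  "lower s = vector [0, s * p, - h]"

definition vertices :: "(real ^ 3) set" where
  "vertices = pole ` signs \<union> upper ` signs \<union> lower ` signs"

definition body :: "(real ^ 3) set" where
  "body = convex hull vertices"

text \<open>
The triple \<open>(\<sigma>, r, s)\<close> names the face spanned by \<open>pole \<sigma>\<close>, \<open>upper r\<close> and \<open>lower s\<close>. The
outward normals are scaled so that every supporting plane is at the same level \<open>p * t\<close>.
\<close>
definition normal :: "real \<times> real \<times> real \<Rightarrow> real ^ 3" where
  "normal = (\<lambda>(\<sigma>, r, s). vector [r * (t - \<sigma> * h), s * (t + \<sigma> * h), \<sigma> * p])"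

definition corners :: "real \<times> real \<times> real \<Rightarrow> (real ^ 3) set" where
  "corners = (\<lambda>(\<sigma>, r, s). {pole \<sigma>, upper r, lower s})"

abbreviation triples :: "(real \<times> real \<times> real) set" where
  "triples \<equiv> signs \<times> signs \<times> signs"

lemma inner_3: "(x :: real ^ 3) \<bullet> y = x$1 * y$1 + x$2 * y$2 + x$3 * y$3"
  by (simp add: inner_vec_def sum_3)

lemma t_pos: "0 < t"
  using height by linarith

text \<open>
The values are written as the level \<open>p * t\<close> minus a defect: the defect vanishes when the two
signs agree and is positive, by \<open>\<bar>h\<bar> < t\<close>, when they are opposite.
\<close>
lemma normal_pole:
  "normal (\<sigma>, r, s) \<bullet> pole \<tau> = p * t - p * t * (1 - \<sigma> * \<tau>)"
  by (simp add: inner_3 normal_def pole_def algebra_simps)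

lemma normal_upper:
  "normal (\<sigma>, r, s) \<bullet> upper r' = p * t - p * (t - \<sigma> * h) * (1 - r * r')"
  by (simp add: inner_3 normal_def upper_def algebra_simps)

lemma normal_lower:
  "normal (\<sigma>, r, s) \<bullet> lower s' = p * t - p * (t + \<sigma> * h) * (1 - s * s')"
  by (simp add: inner_3 normal_def lower_def algebra_simps)

lemma sign_gap:
  assumes "\<sigma> \<in> signs"
  shows "0 < t - \<sigma> * h" "0 < t + \<sigma> * h"
  using assms height by auto

lemma normal_corners:
  assumes "i \<in> triples" "x \<in> corners i"
  shows "normal i \<bullet> x = p * t"
  using assms by (auto simp: corners_def normal_pole normal_upper normal_lower)

lemma normal_off_corners:
  assumes "i \<in> triples" "x \<in> vertices - corners i"
  shows "normal i \<bullet> x < p * t"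
proof -
  obtain \<sigma> r s where i: "i = (\<sigma>, r, s)" and sg: "\<sigma> \<in> signs" "r \<in> signs" "s \<in> signs"
    using assms(1) by auto
  have opp: "u * v = -1" if "u \<in> signs" "v \<in> signs" "v \<noteq> u" for u v :: real
    using that by auto
  consider \<tau> where "\<tau> \<in> signs" "\<tau> \<noteq> \<sigma>" "x = pole \<tau>"
    | r' where "r' \<in> signs" "r' \<noteq> r" "x = upper r'"
    | s' where "s' \<in> signs" "s' \<noteq> s" "x = lower s'"
    using assms(2) unfolding vertices_def corners_def i by blast
  then show ?thesis
    by cases
      (use opp sg sign_gap [OF sg(1)] p_pos t_pos in
        \<open>simp_all add: i normal_pole normal_upper normal_lower del: insert_iff\<close>)
qed

lemma corners_subset: "i \<in> triples \<Longrightarrow> corners i \<subseteq> vertices"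
  by (auto simp: corners_def vertices_def)

lemma finite_vertices: "finite vertices"
  by (simp add: vertices_def)

lemma face_over_corners:
  assumes "i \<in> triples"
  shows "body \<inter> {x. normal i \<bullet> x = p * t} = convex hull corners i"
    and "convex hull corners i face_of body"
  unfolding body_def
  using convex_hull_Int_supporting_hyperplane [OF finite_vertices corners_subset [OF assms]
      normal_corners [OF assms] normal_off_corners [OF assms]]
  by auto

text \<open>
The axis between the poles cuts the octahedron into four tetrahedra, one for each quadrant of the
horizontal plane. For a point of the half-space intersection, the tetrahedron is chosen by the signs of
the first two coordinates; these coordinates give the barycentric weights of the two equatorial
vertices, and the two half-space conditions of that quadrant say precisely that the weights of the
two poles are nonnegative.
\<close>
lemma body_halfspaces: "body = {x. \<forall>i\<in>triples. normal i \<bullet> x \<le> p * t}"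
proof
  have "normal i \<bullet> x \<le> p * t" if "i \<in> triples" "x \<in> vertices" for i x
    using normal_corners [OF that(1), of x] normal_off_corners [OF that(1), of x] that(2)
    by (cases "x \<in> corners i") auto
  then have "vertices \<subseteq> {x. \<forall>i\<in>triples. normal i \<bullet> x \<le> p * t}"
    by blast
  moreover have "convex {x. \<forall>i\<in>triples. normal i \<bullet> x \<le> p * t}"
  proof -
    have "{x. \<forall>i\<in>triples. normal i \<bullet> x \<le> p * t} = (\<Inter>i\<in>triples. {x. normal i \<bullet> x \<le> p * t})"
      by blast
    then show ?thesis
      by (simp only: convex_INT convex_halfspace_le)
  qed
  ultimately show "body \<subseteq> {x. \<forall>i\<in>triples. normal i \<bullet> x \<le> p * t}"
    unfolding body_def by (rule hull_minimal)
  show "{x. \<forall>i\<in>triples. normal i \<bullet> x \<le> p * t} \<subseteq> body"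
  proof
    fix x assume "x \<in> {x. \<forall>i\<in>triples. normal i \<bullet> x \<le> p * t}"
    then have le: "normal i \<bullet> x \<le> p * t" if "i \<in> triples" for i
      using that by blast
    define r s :: real where "r = (if 0 \<le> x$1 then 1 else -1)" and "s = (if 0 \<le> x$2 then 1 else -1)"
    define u v where "u = r * x$1 / p" and "v = s * x$2 / p"
    \<comment> \<open>\<open>z\<close> is the height that the two poles have to contribute.\<close>
    define z where "z = x$3 - h * u + h * v"
    define \<alpha> \<beta> where "\<alpha> = (1 - u - v + z / t) / 2" and "\<beta> = (1 - u - v - z / t) / 2"
    have rs: "r \<in> signs" "s \<in> signs"
      by (auto simp: r_def s_def)
    have uv: "0 \<le> u" "0 \<le> v"
      using p_pos by (auto simp: u_def v_def r_def s_def divide_nonpos_pos)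
    have x12: "x$1 = u * (r * p)" "x$2 = v * (s * p)"
      using p_pos by (auto simp: u_def v_def r_def s_def)
    have rx: "r * x$1 = u * p" "s * x$2 = v * p"
      using p_pos by (auto simp: u_def v_def)
    have *: "\<sigma> * z \<le> t * (1 - u - v)" if "\<sigma> \<in> signs" for \<sigma>
    proof -
      have "normal (\<sigma>, r, s) \<bullet> x \<le> p * t"
        using le that rs by blast
      moreover have "normal (\<sigma>, r, s) \<bullet> x
          = (r * x$1) * (t - \<sigma> * h) + (s * x$2) * (t + \<sigma> * h) + \<sigma> * p * x$3"
        by (simp add: normal_def inner_3)
      ultimately have "p * (\<sigma> * z) \<le> p * (t * (1 - u - v))"
        unfolding rx z_def by (simp add: algebra_simps)
      then show ?thesis
        using p_pos by simp
    qed
    have "0 \<le> \<alpha>" "0 \<le> \<beta>"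
      using *[of 1] *[of "-1"] t_pos by (auto simp: \<alpha>_def \<beta>_def field_simps)
    moreover have "\<alpha> + \<beta> + u + v = 1"
      by (simp add: \<alpha>_def \<beta>_def field_simps)
    moreover have "x = \<alpha> *\<^sub>R pole 1 + \<beta> *\<^sub>R pole (-1) + u *\<^sub>R upper r + v *\<^sub>R lower s"
    proof -
      have "\<alpha> * t - \<beta> * t = z"
        using t_pos by (simp add: \<alpha>_def \<beta>_def field_simps)
      then show ?thesis
        using x12 by (simp add: vec_eq_iff forall_3 pole_def upper_def lower_def z_def algebra_simps)
    qed
    moreover have "pole 1 \<in> body" "pole (-1) \<in> body" "upper r \<in> body" "lower s \<in> body"
      using rs by (auto simp: body_def vertices_def intro!: hull_inc)
    ultimately show "x \<in> body"
      using convex_combination_4 [of body] uv by (simp add: body_def)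
  qed
qed

lemma strict_halfspaces_subset_interior:
  "{x. \<forall>i\<in>triples. normal i \<bullet> x < p * t} \<subseteq> interior body"
proof (rule interior_maximal)
  show "{x. \<forall>i\<in>triples. normal i \<bullet> x < p * t} \<subseteq> body"
    by (auto simp: body_halfspaces less_imp_le)
  have "{x. \<forall>i\<in>triples. normal i \<bullet> x < p * t} = (\<Inter>i\<in>triples. {x. normal i \<bullet> x < p * t})"
    by blast
  then show "open {x. \<forall>i\<in>triples. normal i \<bullet> x < p * t}"
    using open_INT [of triples "\<lambda>i. {x. normal i \<bullet> x < p * t}"] by (simp add: open_halfspace_lt)
qed

lemma interior_body: "interior body \<noteq> {}"
proof -
  have "0 \<in> {x. \<forall>i\<in>triples. normal i \<bullet> x < p * t}"
    using p_pos t_pos by simp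
  then show ?thesis
    using strict_halfspaces_subset_interior by blast
qed

lemma convex_polyhedron_body: "convex_polyhedron body"
  using interior_body finite_vertices by (auto simp: convex_polyhedron_def polytope_def body_def)

text \<open>
A face determines its triple, because its corners all lie in the supporting plane of that triple and a
vertex with a wrong sign lies strictly below this plane.
\<close>
lemma inj_on_faces: "inj_on (\<lambda>i. convex hull corners i) triples"
proof (rule inj_onI)
  fix i j
  assume i: "i \<in> triples" and j: "j \<in> triples"
    and eq: "convex hull corners i = convex hull corners j"
  have "convex hull corners i \<subseteq> {x. normal i \<bullet> x = p * t}"
    by (rule hull_minimal) (use normal_corners i in \<open>auto simp: convex_hyperplane\<close>)
  then have on: "normal i \<bullet> x = p * t" if "x \<in> corners j" for x
    using eq hull_inc [OF that, of convex] by auto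
  show "i = j"
  proof -
    obtain \<sigma> r s \<sigma>' r' s' where ij: "i = (\<sigma>, r, s)" "j = (\<sigma>', r', s')"
      by (metis prod_cases3)
    have sg: "\<sigma> \<in> signs" "r \<in> signs" "s \<in> signs" "\<sigma>' \<in> signs" "r' \<in> signs" "s' \<in> signs"
      using i j ij by auto
    have "\<sigma> * \<sigma>' = 1" "r * r' = 1" "s * s' = 1"
      using on [of "pole \<sigma>'"] on [of "upper r'"] on [of "lower s'"] sign_gap [OF sg(1)] p_pos t_pos
      by (auto simp: ij corners_def normal_pole normal_upper normal_lower)
    then show ?thesis
      using sg unfolding ij by auto
  qed
qed

lemma edge_lengths:
  assumes "\<sigma> \<in> signs" "r \<in> signs" "s \<in> signs"
  shows "dist (pole \<sigma>) (upper r) = sqrt (p\<^sup>2 + t\<^sup>2 + h\<^sup>2 - 2 * \<sigma> * (t * h))"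
    and "dist (pole \<sigma>) (lower s) = sqrt (p\<^sup>2 + t\<^sup>2 + h\<^sup>2 + 2 * \<sigma> * (t * h))"
    and "dist (upper r) (lower s) = sqrt (2 * p\<^sup>2 + 4 * h\<^sup>2)"
  using assms
  by (auto simp: dist_norm norm_eq_sqrt_inner inner_3 pole_def upper_def lower_def power2_eq_square
      algebra_simps)

lemma face_congruent:
  assumes "i \<in> triples"
    and "(dist a b)\<^sup>2 = p\<^sup>2 + t\<^sup>2 + h\<^sup>2 - 2 * (t * h)" "(dist a c)\<^sup>2 = p\<^sup>2 + t\<^sup>2 + h\<^sup>2 + 2 * (t * h)"
    and "(dist b c)\<^sup>2 = 2 * p\<^sup>2 + 4 * h\<^sup>2"
  shows "euclidean_congruent (convex hull corners i) (convex hull {a, b, c})"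
proof -
  obtain \<sigma> r s where i: "i = (\<sigma>, r, s)" and sg: "\<sigma> \<in> signs" "r \<in> signs" "s \<in> signs"
    using assms(1) by auto
  have len: "dist a b = sqrt (p\<^sup>2 + t\<^sup>2 + h\<^sup>2 - 2 * (t * h))"
      "dist a c = sqrt (p\<^sup>2 + t\<^sup>2 + h\<^sup>2 + 2 * (t * h))" "dist b c = sqrt (2 * p\<^sup>2 + 4 * h\<^sup>2)"
    unfolding assms(2-4) [symmetric] by simp_all
  consider "\<sigma> = 1" | "\<sigma> = -1"
    using sg by auto
  then show ?thesis
  proof cases
    case 1
    then show ?thesis
      using edge_lengths [OF sg] len
      by (simp add: i corners_def euclidean_congruent_triangles)
  next
    \<comment> \<open>At the lower pole the two polar edge lengths are interchanged.\<close>
    case 2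
    then have "euclidean_congruent (convex hull {pole \<sigma>, upper r, lower s}) (convex hull {a, c, b})"
      using edge_lengths [OF sg] len by (intro euclidean_congruent_triangles) (simp_all add: dist_commute)
    then show ?thesis
      by (simp add: i corners_def insert_commute)
  qed
qed

text \<open>
The dimension of the faces enters as a hypothesis because it is inherited from the given triangle
once the congruence is known, which avoids computing with the corners.
\<close>
lemma facets_body:
  assumes "\<And>i. i \<in> triples \<Longrightarrow> aff_dim (convex hull corners i) = 2"
  shows "{F. F facet_of body} = (\<lambda>i. convex hull corners i) ` triples"
proof (rule facets_eqI)
  have "aff_dim body = 3"
    using aff_dim_nonempty_interior [OF interior_body] by simp
  then show "convex hull corners i facet_of body" if "i \<in> triples" for i
    using that assms face_over_corners by (auto simp: facet_of_def corners_def)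
  show "body - interior body \<subseteq> (\<Union>i\<in>triples. convex hull corners i)"
  proof
    fix x assume x: "x \<in> body - interior body"
    then obtain i where i: "i \<in> triples" and "\<not> normal i \<bullet> x < p * t"
      using strict_halfspaces_subset_interior by blast
    then have nx: "normal i \<bullet> x = p * t"
      using x body_halfspaces by fastforce
    then have "x \<in> convex hull corners i"
      using x face_over_corners(1) [OF i] by blast
    then show "x \<in> (\<Union>i\<in>triples. convex hull corners i)"
      using i by blast
  qed
qed

end

section \<open>Fitting the octahedron to a given triangle\<close>

text \<open>
The inner products belonging to the angles at \<open>a\<close> and \<open>b\<close> add up to the squared length of the side
between them, so one of the two is positive.
\<close>
lemma acute_angle_exists:
  fixes T :: "'a::euclidean_space set"
  assumes "nondegenerate_triangle T"
  obtains a b c where "\<not> collinear {a, b, c}" "T = convex hull {a, b, c}" "0 < (b - a) \<bullet> (c - a)"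
proof -
  obtain a b c where abc: "\<not> collinear {a, b, c}" "T = convex hull {a, b, c}"
    using assms by (auto simp: nondegenerate_triangle_def)
  have "(b - a) \<bullet> (c - a) + (a - b) \<bullet> (c - b) = (b - a) \<bullet> (b - a)"
    by (simp add: algebra_simps inner_commute)
  moreover have "0 < (b - a) \<bullet> (b - a)"
    using abc(1) by auto
  ultimately consider "0 < (b - a) \<bullet> (c - a)" | "0 < (a - b) \<bullet> (c - b)"
    by linarith
  then show thesis
    by cases (use abc that [of a b c] that [of b a c] in \<open>simp_all add: insert_commute\<close>)
qed

text \<open>
With \<open>g = u \<bullet> v\<close> and \<open>d = (v \<bullet> v - u \<bullet> u) / 2\<close>, the number \<open>t + i h\<close> is the square root of
\<open>g + i d\<close> with positive real part, and \<open>R\<close> is the modulus of \<open>g + i d\<close>. Adding up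
the squared polar edge lengths leaves \<open>p^2 = m - R\<close>, where \<open>m\<close> is their mean. The identity
\<open>m^2 - d^2 = (u \<bullet> u) (v \<bullet> v)\<close> makes \<open>R < m\<close> equivalent to strict Cauchy-Schwarz, while
\<open>\<bar>h\<bar> < t\<close> follows from \<open>t^2 - h^2 = g > 0\<close>.
\<close>
lemma octahedron_parameters:
  fixes u v :: "'a::euclidean_space"
  assumes acute: "0 < u \<bullet> v" and indep: "\<not> collinear {0, u, v}"
  obtains p h t :: real where "0 < p" "\<bar>h\<bar> < t"
    "(norm u)\<^sup>2 = p\<^sup>2 + t\<^sup>2 + h\<^sup>2 - 2 * (t * h)" "(norm v)\<^sup>2 = p\<^sup>2 + t\<^sup>2 + h\<^sup>2 + 2 * (t * h)"
    "(norm (u - v))\<^sup>2 = 2 * p\<^sup>2 + 4 * h\<^sup>2"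
proof -
  define g d m where "g = u \<bullet> v" and "d = ((norm v)\<^sup>2 - (norm u)\<^sup>2) / 2"
    and "m = ((norm v)\<^sup>2 + (norm u)\<^sup>2) / 2"
  define R where "R = sqrt (g\<^sup>2 + d\<^sup>2)"
  define t h p where "t = sqrt ((R + g) / 2)" and "h = d / (2 * t)" and "p = sqrt (m - R)"
  have "g > 0"
    using acute by (simp add: g_def)
  have R2: "R\<^sup>2 = g\<^sup>2 + d\<^sup>2" and "R \<ge> 0"
    by (simp_all add: R_def)
  then have Rg: "R + g > 0"
    using \<open>g > 0\<close> by linarith
  have t: "t > 0" "t\<^sup>2 = (R + g) / 2"
    using Rg by (simp_all add: t_def)
  have th: "t * h = d / 2"
    using t by (simp add: h_def)
  have h: "h\<^sup>2 = (R - g) / 2"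
  proof -
    have "(R + g) * h\<^sup>2 = (R + g) * ((R - g) / 2)"
    proof -
      have "(R + g) * h\<^sup>2 = 2 * (t * h)\<^sup>2"
        using t(2) by (simp add: power_mult_distrib)
      also have "\<dots> = (R\<^sup>2 - g\<^sup>2) / 2"
        unfolding th by (simp add: R2 power_divide)
      finally show ?thesis
        by (simp add: power2_eq_square algebra_simps)
    qed
    then show ?thesis
      using Rg by simp
  qed
  have "g < norm u * norm v"
    using indep norm_cauchy_schwarz [of u v] Cauchy_Schwarz_ineq2 [of u v] acute
    by (auto simp: g_def norm_cauchy_schwarz_equal [symmetric] less_le)
  then have "g\<^sup>2 < (norm u * norm v)\<^sup>2"
    using \<open>g > 0\<close> by (simp add: power_strict_mono)
  also have "(norm u * norm v)\<^sup>2 = m\<^sup>2 - d\<^sup>2"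
    by (simp add: m_def d_def power2_eq_square field_simps)
  finally have "R\<^sup>2 < m\<^sup>2"
    using R2 by simp
  then have "R < m"
    by (rule power2_less_imp_less) (simp add: m_def)
  then have p: "p > 0" "p\<^sup>2 = m - R"
    by (simp_all add: p_def)
  show thesis
  proof (rule that)
    have "\<bar>h\<bar>\<^sup>2 < t\<^sup>2"
      using h t(2) \<open>g > 0\<close> by simp
    then show "\<bar>h\<bar> < t"
      by (rule power2_less_imp_less) (use t in simp)
    have "(norm (u - v))\<^sup>2 = 2 * m - 2 * g"
      by (simp add: m_def g_def power2_norm_eq_inner algebra_simps inner_commute)
    then show "(norm (u - v))\<^sup>2 = 2 * p\<^sup>2 + 4 * h\<^sup>2"
      using p(2) h by simp
    show "(norm u)\<^sup>2 = p\<^sup>2 + t\<^sup>2 + h\<^sup>2 - 2 * (t * h)" "(norm v)\<^sup>2 = p\<^sup>2 + t\<^sup>2 + h\<^sup>2 + 2 * (t * h)"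
      unfolding th p(2) h t(2) by (simp_all add: m_def d_def field_simps)
  qed (fact p(1))
qed

theorem theorem1:
  fixes T :: "(real ^ 3) set"
  assumes "nondegenerate_triangle T"
  shows "\<exists>P :: (real ^ 3) set. convex_polyhedron P \<and> card {F. F facet_of P} = 8 \<and>
           (\<forall>F. F facet_of P \<longrightarrow> euclidean_congruent F T)"
proof -
  obtain a b c where T: "\<not> collinear {a, b, c}" "T = convex hull {a, b, c}"
      and acute: "0 < (b - a) \<bullet> (c - a)"
    using acute_angle_exists [OF assms] .
  have "\<not> collinear {0, b - a, c - a}"
    using T(1) collinear_3 [of b a c] by (simp add: insert_commute)
  then obtain p h t where pht: "0 < p" "\<bar>h\<bar> < t"
      and len: "(norm (b - a))\<^sup>2 = p\<^sup>2 + t\<^sup>2 + h\<^sup>2 - 2 * (t * h)"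
        "(norm (c - a))\<^sup>2 = p\<^sup>2 + t\<^sup>2 + h\<^sup>2 + 2 * (t * h)"
        "(norm ((b - a) - (c - a)))\<^sup>2 = 2 * p\<^sup>2 + 4 * h\<^sup>2"
    by (rule octahedron_parameters [OF acute])
  interpret skew_octahedron p h t
    using pht by unfold_locales
  have congruent: "euclidean_congruent (convex hull corners i) T" if "i \<in> triples" for i
    unfolding T(2) by (rule face_congruent [OF that])
      (use len in \<open>simp_all add: dist_norm norm_minus_commute\<close>)
  then have "aff_dim (convex hull corners i) = 2" if "i \<in> triples" for i
    using aff_dim_euclidean_congruent [OF congruent [OF that]] aff_dim_triangle [OF T(1)] T(2) by simp
  then have facets: "{F. F facet_of body} = (\<lambda>i. convex hull corners i) ` triples"
    by (rule facets_body)
  then have "card {F. F facet_of body} = 8"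
    by (simp only: card_image [OF inj_on_faces]) (simp add: card_cartesian_product)
  moreover have "euclidean_congruent F T" if "F facet_of body" for F
  proof -
    have "F \<in> (\<lambda>i. convex hull corners i) ` triples"
      using that facets by blast
    then show ?thesis
      using congruent by (elim imageE) simp
  qed
  ultimately show ?thesis
    using convex_polyhedron_body by blast
qed

end
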